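(* Let $N$ be a friend of $20$. Then there exist positive integers $a, m$ such that $N = 2\cdot 5^{2a} m^2$ with $\gcd(3,m)=\gcd(7,m)=1$. Further, $N$ has at least six distinct prime divisors.
   Context: For a positive integer $n$, $\sigma(n)$ denotes the sum of the positive divisors of $n$, and the abundancy index of $n$ is $I(n)=\sigma(n)/n$. A positive integer $N>20$ is called a friend of $20$ if $I(N)=I(20)=21/10$. *)

theory Defs
  imports Complex_Main "HOL-Number_Theory.Number_Theory"
begin

definition divisor_sigma :: "nat \<Rightarrow> nat" where
  "divisor_sigma n = (\<Sum>d | d dvd n. d)"

definition abundancy :: "nat \<Rightarrow> real" where
  "abundancy n = real (divisor_sigma n) / real n"

definition friend_of_20 :: "nat \<Rightarrow> bool" where
  "friend_of_20 N \<longleftrightarrow> N > 20 \<and> abundancy N = abundancy 20"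

lemma abundancy_20: "abundancy 20 = 21 / 10"
proof -
  have "d \<in> {1, 2, 4, 5, 10, 20}" if "d dvd 20" for d :: nat
  proof -
    have "d = 0 \<or> d = 1 \<or> d = 2 \<or> d = 3 \<or> d = 4 \<or> d = 5 \<or> d = 6 \<or> d = 7 \<or> d = 8
        \<or> d = 9 \<or> d = 10 \<or> d = 11 \<or> d = 12 \<or> d = 13 \<or> d = 14 \<or> d = 15 \<or> d = 16
        \<or> d = 17 \<or> d = 18 \<or> d = 19 \<or> d = 20"
      using dvd_imp_le[OF that] by (simp, presburger)
    then show ?thesis
      using that by auto
  qed
  then have "{d::nat. d dvd 20} = {1, 2, 4, 5, 10, 20}"
    by auto
  then show ?thesis
    by (simp add: abundancy_def divisor_sigma_def)
qed

end

theory Submission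
  imports Defs
begin

text \<open>
  If \<open>N\<close> is a friend of 20, then \<open>4\<close> cannot divide \<open>N\<close>, since a proper multiple of 20 has larger
  abundancy. Hence \<open>N = 2 k\<close> with \<open>k\<close> odd and \<open>5 \<sigma>(k) = 7 k\<close>; as \<open>\<sigma>(k)\<close> is odd, \<open>k\<close> is a
  square, and \<open>3\<close> or \<open>7\<close> dividing \<open>k\<close> would make the abundancy of \<open>k\<close> too large.

  Suppose that \<open>k\<close> has at most four prime divisors. As \<open>25\<close> divides \<open>k\<close>, \<open>5\<close> divides some
  \<open>\<sigma>(p\<^sup>e)\<close> with \<open>e\<close> even; then \<open>p\<close> is 1 modulo 5 and \<open>1 + p + \<dots> + p\<^sup>4\<close> divides \<open>7 k\<close>, which
  gives a second prime divisor of \<open>k\<close> that is 1 modulo 5. In the same way the factor 7 of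
  \<open>\<sigma>(k)\<close> yields either two prime divisors that are 1 modulo 7, or one prime \<open>p\<close> that is 2 or 4
  modulo 7 and 2 modulo 3 with \<open>1 + p + p\<^sup>2\<close> dividing \<open>7 k\<close>. Together with
  \<open>7/5 \<le> \<Prod> p / (p - 1)\<close> this leaves finitely many sets of primes: if 11 divides \<open>k\<close>, then
  \<open>5\<^sup>4\<close> and \<open>11\<^sup>4\<close> do too and all other primes are at least 59; otherwise the primes are 5, 17, 31, 41,
  or 5 and 13 with 31 or 41 and a bounded fourth prime.
\<close>

section \<open>Divisor sums: multiplicativity, bounds and parity\<close>

lemma divisor_sigma_prime_power:
  assumes "prime p"
  shows "divisor_sigma (p ^ e) = (\<Sum>i\<le>e. p ^ i)"
proof -
  have "{d. d dvd p ^ e} = (\<lambda>i. p ^ i) ` {..e}"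
    using divides_primepow_nat[OF assms] by auto
  moreover have "inj_on (\<lambda>i. p ^ i) {..e}"
    using prime_gt_1_nat[OF assms] by (auto simp: inj_on_def)
  ultimately show ?thesis
    unfolding divisor_sigma_def by (simp add: sum.reindex)
qed

lemma divisor_sigma_prime_square: "prime p \<Longrightarrow> divisor_sigma (p ^ 2) = 1 + p + p ^ 2"
  by (simp add: divisor_sigma_prime_power) (simp add: numeral_eq_Suc)

lemma divisor_sigma_mult_coprime:
  assumes "coprime a b"
  shows "divisor_sigma (a * b) = divisor_sigma a * divisor_sigma b"
proof -
  let ?D = "\<lambda>n. {d::nat. d dvd n}"
  have inj: "inj_on (\<lambda>(x, y). x * y) (?D a \<times> ?D b)"
  proof (rule inj_onI, clarify)
    fix x y x' y' assume h: "x dvd a" "y dvd b" "x' dvd a" "y' dvd b" "x * y = x' * y'"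
    have "coprime x y'" "coprime x' y"
      using h assms by (meson coprime_divisors)+
    then have "x dvd x'" "x' dvd x" 
      using h(5) by (metis coprime_dvd_mult_left_iff dvd_triv_left)+
    then have "x = x'" by (rule dvd_antisym)
    moreover have "coprime x y" "coprime x' y'" "coprime y x'" 
      using h assms by (meson coprime_divisors coprime_commute)+
    then have "y dvd y'" "y' dvd y" 
      using h(5) \<open>coprime x y'\<close> by (metis coprime_commute coprime_dvd_mult_right_iff dvd_triv_right)+
    then have "y = y'" by (rule dvd_antisym)
    ultimately show "x = x' \<and> y = y'" by simp
  qed
  have img: "?D (a * b) = (\<lambda>(x, y). x * y) ` (?D a \<times> ?D b)"
    by (auto simp: image_def elim!: dvd_productE intro: mult_dvd_mono)
  have "divisor_sigma (a * b) = (\<Sum>(x, y)\<in>?D a \<times> ?D b. x * y)"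
    using sum.reindex[OF inj, of id] by (simp add: divisor_sigma_def img case_prod_unfold)
  then show ?thesis
    unfolding divisor_sigma_def by (simp add: sum.cartesian_product sum_product)
qed

text \<open>Multiplying the divisors of \<open>d\<close> by \<open>c\<close> gives distinct divisors
  of \<open>d * c\<close>; for \<open>c > 1\<close> the divisor 1 is not among them. Hence abundancy
  grows along multiples.\<close>

lemma divisor_sigma_mult_le:
  assumes "d > 0" "c > 0"
  shows "divisor_sigma d * c \<le> divisor_sigma (d * c)"
    and "c > 1 \<Longrightarrow> divisor_sigma d * c < divisor_sigma (d * c)"
proof -
  let ?I = "(\<lambda>x. x * c) ` {x. x dvd d}"
  have fin: "finite {x. x dvd d * c}" using assms by simp
  have sub: "?I \<subseteq> {x. x dvd d * c}" by auto
  have I: "divisor_sigma d * c = \<Sum> ?I"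
    using assms by (subst sum.reindex) (auto simp: inj_on_def divisor_sigma_def sum_distrib_right)
  show "divisor_sigma d * c \<le> divisor_sigma (d * c)"
    using sum_mono2[OF fin sub, of id] I by (simp add: divisor_sigma_def)
  assume c: "c > 1"
  have "1 \<notin> ?I" using c by (metis imageE less_numeral_extra(4) nat_mult_eq_1_iff)
  then have "\<Sum> ?I < \<Sum> {x. x dvd d * c}"
    by (intro sum_strict_mono2[OF fin sub, of 1]) simp_all
  then show "divisor_sigma d * c < divisor_sigma (d * c)"
    using I by (simp add: divisor_sigma_def)
qed

lemma prime_factor_split:
  fixes n p :: nat
  assumes "n > 0" "prime p"
  obtains m where "n = p ^ multiplicity p n * m" "\<not> p dvd m" "m > 0"
proof -
  have "n \<noteq> 0" "\<not> is_unit p" using assms not_prime_unit by auto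
  then obtain m where "n = p ^ multiplicity p n * m" "\<not> p dvd m"
    by (rule multiplicity_decompose')
  moreover from this(2) have "m > 0" by (cases m) auto
  ultimately show thesis by (rule that)
qed

lemma divisor_sigma_prod:
  "n > 0 \<Longrightarrow> divisor_sigma n = (\<Prod>p\<in>prime_factors n. divisor_sigma (p ^ multiplicity p n))"
proof (induction n rule: less_induct)
  case (less n)
  show ?case
  proof (cases "n = 1")
    case True
    then show ?thesis by (simp add: divisor_sigma_def)
  next
    case False
    then obtain p where p: "prime p" "p dvd n" using prime_factor_nat by blast
    obtain m where m: "n = p ^ multiplicity p n * m" "\<not> p dvd m" "m > 0"
      using prime_factor_split[OF less.prems p(1)] .
    define e where "e = multiplicity p n"
    have n: "n = p ^ e * m" using m e_def by simp
    have e: "e > 0" using p less.prems by (simp add: e_def prime_multiplicity_gt_zero_iff)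
    have "p ^ e > 1" using e p prime_gt_1_nat one_less_power by blast
    then have "m < n" unfolding n using m(3) by simp
    have cop: "coprime (p ^ e) m" using p m by (simp add: prime_imp_coprime)
    have pf: "prime_factors n = insert p (prime_factors m)"
      unfolding n using p m e by (simp add: prime_factors_product prime_factorization_prime_power)
    have np: "p \<notin> prime_factors m" using m by auto
    have mult: "multiplicity q n = multiplicity q m" if "q \<in> prime_factors m" for q
    proof -
      have q: "prime q" "q \<noteq> p" using that np by auto
      then have "multiplicity q (p ^ e) = 0"
        using p(1) by (simp add: multiplicity_distinct_prime_power)
      then show ?thesis
        unfolding n using q p(1) m(3) by (subst prime_elem_multiplicity_mult_distrib) auto
    qed
    have "divisor_sigma n = divisor_sigma (p ^ e) * divisor_sigma m"
      using divisor_sigma_mult_coprime[OF cop] n by simp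
    also have "divisor_sigma m = (\<Prod>q\<in>prime_factors m. divisor_sigma (q ^ multiplicity q n))"
      using less.IH[OF \<open>m < n\<close> m(3)] mult by simp
    finally show ?thesis unfolding pf using np by (simp add: e_def)
  qed
qed

lemma geometric_sum_nat:
  "(p - 1) * (\<Sum>i\<le>e. p ^ i) = p ^ Suc e - (1::nat)" if "p > 0"
proof -
  have "int p ^ Suc e - 1 = (int p - 1) * (\<Sum>i<Suc e. int p ^ i)"
    by (rule power_diff_1_eq)
  then have "int ((p - 1) * (\<Sum>i\<le>e. p ^ i)) = int (p ^ Suc e - 1)"
    using that by (simp add: lessThan_Suc_atMost of_nat_diff)
  then show ?thesis by linarith
qed

text \<open>Factor by factor, \<open>(p - 1) * divisor_sigma (p ^ e) = p ^ Suc e - 1\<close>. A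
  prime of \<open>P\<close> outside \<open>prime_factors n\<close> has \<open>e = 0\<close> and
  contributes only \<open>p - 1 \<le> p\<close>, so \<open>P\<close> may be padded.\<close>

lemma divisor_sigma_prod_upper:
  fixes P :: "nat set"
  assumes "n > 0" "finite P" "\<And>p. p \<in> P \<Longrightarrow> prime p" "prime_factors n \<subseteq> P"
  shows "divisor_sigma n * (\<Prod>p\<in>P. p - 1) \<le> n * \<Prod>P"
proof -
  have *: "divisor_sigma (p ^ multiplicity p n) * (p - 1) \<le> p ^ multiplicity p n * p" if "p \<in> P" for p
    using geometric_sum_nat[of p "multiplicity p n"] prime_gt_0_nat[OF assms(3)[OF that]]
    by (simp add: divisor_sigma_prime_power[OF assms(3)[OF that]] mult.commute)
  have one: "multiplicity p n = 0" if "p \<in> P - prime_factors n" for p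
    using that assms by (auto simp: prime_factors_multiplicity)
  have "divisor_sigma n = (\<Prod>p\<in>P. divisor_sigma (p ^ multiplicity p n))"
    unfolding divisor_sigma_prod[OF assms(1)]
    by (rule prod.mono_neutral_left) (use assms one in \<open>auto simp: divisor_sigma_def\<close>)
  moreover have "n = (\<Prod>p\<in>P. p ^ multiplicity p n)"
  proof -
    have "n = (\<Prod>p\<in>prime_factors n. p ^ multiplicity p n)"
      using prime_factorization_nat assms(1) by blast
    also have "\<dots> = (\<Prod>p\<in>P. p ^ multiplicity p n)"
      by (rule prod.mono_neutral_left) (use assms one in auto)
    finally show ?thesis .
  qed
  ultimately show ?thesis
    using prod_mono[of P "\<lambda>p. divisor_sigma (p ^ multiplicity p n) * (p - 1)" "\<lambda>p. p ^ multiplicity p n * p"] *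
    by (simp add: prod.distrib)
qed

text \<open>For odd \<open>p\<close> the sum \<open>1 + p + ... + p ^ e\<close> has
  \<open>e + 1\<close> odd terms, so it is odd exactly when \<open>e\<close> is even.\<close>

lemma odd_divisor_sigma_imp_even_multiplicity:
  assumes "odd n" "odd (divisor_sigma n)" "prime p"
  shows "even (multiplicity p n)"
proof (cases "p \<in> prime_factors n")
  case True
  have n: "n > 0" using assms by (cases n) auto
  have p: "prime p" "odd p" using True assms by (auto simp: in_prime_factors_iff)
  have "divisor_sigma (p ^ multiplicity p n) dvd divisor_sigma n"
    unfolding divisor_sigma_prod[OF n] using True by (intro dvd_prodI) auto
  then have "odd (\<Sum>i\<le>multiplicity p n. p ^ i)"
    using assms p by (metis divisor_sigma_prime_power dvd_trans)
  moreover have "even (\<Sum>i\<le>e. p ^ i) \<longleftrightarrow> odd e" for e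
    using p by (induction e) auto
  ultimately show ?thesis by blast
next
  case False
  then show ?thesis
    using assms(3) by (auto simp: prime_factors_multiplicity not_dvd_imp_multiplicity_0)
qed

lemma divisor_sigma_prime_power_dvd:
  assumes "n > 0" "prime p" "p dvd n"
  shows "(\<Sum>i\<le>multiplicity p n. p ^ i) dvd divisor_sigma n"
proof -
  have "p \<in> prime_factors n" using assms by (auto simp: in_prime_factors_iff)
  then have "divisor_sigma (p ^ multiplicity p n) dvd divisor_sigma n"
    unfolding divisor_sigma_prod[OF assms(1)] by (intro dvd_prodI) auto
  then show ?thesis using assms(2) by (simp add: divisor_sigma_prime_power)
qed

lemma prime_dvd_divisor_sigmaE:
  assumes "n > 0" "prime q" "q dvd divisor_sigma n"
  obtains p where "prime p" "p dvd n" "q dvd (\<Sum>i\<le>multiplicity p n. p ^ i)"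
proof -
  obtain p where p: "p \<in> prime_factors n" "q dvd divisor_sigma (p ^ multiplicity p n)"
    using assms unfolding divisor_sigma_prod[OF assms(1)] by (auto simp: prime_dvd_prod_iff)
  then have "prime p" "p dvd n" by auto
  then show thesis using p(2) that by (simp add: divisor_sigma_prime_power)
qed

section \<open>Geometric sums and their prime divisors\<close>

lemma geometric_sum_mod_one:
  fixes p q :: nat
  assumes "[p = 1] (mod q)"
  shows "[(\<Sum>i<n. p ^ i) = n] (mod q)"
proof -
  have "[(\<Sum>i<n. p ^ i) = (\<Sum>i<n. 1)] (mod q)"
    using assms by (intro cong_sum) (metis cong_pow power_one)
  then show ?thesis by simp
qed

lemma dvd_geometric_sum_imp_cong:
  fixes p q :: nat
  assumes "q dvd (\<Sum>i<n. p ^ i)" "p > 0"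
  shows "[p ^ n = 1] (mod q)"
proof (cases n)
  case (Suc m)
  have "q dvd p ^ n - 1"
    using geometric_sum_nat[OF assms(2), of m] assms(1)
    by (metis Suc dvd_mult lessThan_Suc_atMost)
  then show ?thesis
    using assms(2) by (simp add: cong_altdef_nat)
qed simp

text \<open>With \<open>n = s * c\<close>, \<open>p ^ s - 1\<close> divides
  \<open>(p ^ s) ^ c - 1\<close>; cancelling \<open>p - 1\<close> gives the claim.\<close>

lemma geometric_sum_dvd:
  fixes p s :: nat
  assumes "s dvd n" "p > 1"
  shows "(\<Sum>i<s. p ^ i) dvd (\<Sum>i<n. p ^ i)"
proof -
  obtain c where n: "n = s * c" using assms(1) by blast
  have "(p ^ s) ^ c - 1 = (p ^ s - 1) * (\<Sum>i<c. (p ^ s) ^ i)" if "s > 0"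
  proof (cases c)
    case (Suc d)
    then show ?thesis using geometric_sum_nat[of "p ^ s" d] assms by (simp add: lessThan_Suc_atMost)
  qed simp
  then have 1: "p ^ n - 1 = (p ^ s - 1) * (\<Sum>i<c. (p ^ s) ^ i)"
    by (cases "s = 0") (auto simp: n power_mult)
  have 2: "p ^ k - 1 = (p - 1) * (\<Sum>i<k. p ^ i)" for k
    using geometric_sum_nat[of p "k - 1"] assms by (cases k) (auto simp: lessThan_Suc_atMost)
  have "(p - 1) * (\<Sum>i<n. p ^ i) = (p - 1) * ((\<Sum>i<s. p ^ i) * (\<Sum>i<c. (p ^ s) ^ i))"
    unfolding mult.assoc[symmetric] 2[symmetric] by (rule 1)
  then show ?thesis using assms(2) by simp
qed

lemma not_dvd_geometric_sum:
  fixes p :: nat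
  assumes "p > 1" "n > 0"
  shows "\<not> p dvd (\<Sum>i<n. p ^ i)"
proof -
  obtain m where n: "n = Suc m" using assms(2) gr0_conv_Suc by blast
  have "(\<Sum>i<n. p ^ i) = 1 + p * (\<Sum>i<m. p ^ i)"
    unfolding n by (simp add: sum.lessThan_Suc_shift sum_distrib_left del: sum.lessThan_Suc)
  then show ?thesis
    using assms(1) by (metis dvd_add_left_iff dvd_triv_left nat_dvd_1_iff_1 less_numeral_extra(4))
qed

text \<open>The order of \<open>p\<close> modulo \<open>r\<close> divides the prime
  \<open>s\<close>. If it is 1, the sum is \<open>s\<close> modulo \<open>r\<close>, so
  \<open>r = s\<close>; if it is \<open>s\<close>, then \<open>s\<close> divides
  \<open>r - 1\<close> by Fermat.\<close>

lemma prime_dvd_cyclotomic: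
  fixes p r s :: nat
  assumes "prime s" "prime r" "r dvd (\<Sum>i<s. p ^ i)" "p > 0"
  shows "r = s \<or> [r = 1] (mod s)"
proof -
  have c: "[p ^ s = 1] (mod r)" using dvd_geometric_sum_imp_cong assms by blast
  have "ord r p dvd s" using c ord_divides by blast
  then consider "ord r p = 1" | "ord r p = s" using assms(1) by (auto simp: prime_nat_iff)
  then show ?thesis
  proof cases
    case 1
    then have "[p = 1] (mod r)" by (metis ord power_one_right)
    then have "r dvd s"
      using geometric_sum_mod_one[of p r s] assms(3) cong_dvd_iff by blast
    then show ?thesis using assms by (auto dest: primes_dvd_imp_eq)
  next
    case 2
    have "\<not> r dvd p"
    proof
      assume "r dvd p"
      then have "r dvd p ^ s" using prime_gt_0_nat[OF assms(1)] dvd_power dvd_trans by blast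
      then have "r dvd 1" using c cong_dvd_iff by blast
      then show False using assms(2) not_prime_unit by blast
    qed
    then have "coprime r p" using assms(2) by (simp add: prime_imp_coprime)
    then have "s dvd totient r" using 2 order_divides_totient[of r p] by simp
    then have "s dvd r - 1" using assms(2) by (simp add: totient_prime)
    then show ?thesis
      using prime_gt_1_nat[OF assms(2)] by (simp add: cong_altdef_nat)
  qed
qed

text \<open>The hypotheses exclude that \<open>x\<close> is a power of \<open>s\<close>: 1 and
  \<open>s\<close> are too small, higher powers are multiples of \<open>s * s\<close>.\<close>

lemma not_square_dvd_imp_other_prime:
  fixes x s :: nat
  assumes "prime s" "x > s" "\<not> s * s dvd x"
  obtains r where "prime r" "r dvd x" "r \<noteq> s"
proof (cases "s dvd x")
  case True
  then obtain y where y: "x = s * y" by blast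
  have "y \<noteq> 1" "\<not> s dvd y" using assms y by auto
  then show thesis using prime_factor_nat[of y] y that by (metis dvd_mult)
next
  case False
  have "x \<noteq> 1" using assms prime_gt_1_nat[of s] by auto
  then show thesis using prime_factor_nat[of x] False that by metis
qed

lemma only_prime_factor_imp_power:
  fixes y T :: nat
  assumes "y > 0" "prime T" "\<And>r. prime r \<Longrightarrow> r dvd y \<Longrightarrow> r = T"
  obtains j where "y = T ^ j"
proof -
  obtain m where m: "y = T ^ multiplicity T y * m" "\<not> T dvd m" "m > 0"
    using prime_factor_split[OF assms(1,2)] .
  have "m = 1"
    using prime_factor_nat[of m] assms(3) m by (metis dvd_mult)
  then show thesis using m that by simp
qed

text \<open>Turns knowledge of the possible prime divisors of a cyclotomic value into an exponential
  equation, which size estimates can then refute.\<close>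

lemma two_prime_factors_imp:
  fixes x s T :: nat
  assumes "x > s" "prime s" "prime T" "s dvd x" "\<not> s * s dvd x"
    and "\<And>r. prime r \<Longrightarrow> r dvd x \<Longrightarrow> r = s \<or> r = T"
  obtains j where "x = s * T ^ j" "j > 0" "T \<noteq> s"
proof -
  obtain y where y: "x = s * y" using assms by blast
  have "\<not> s dvd y" "y > 0" "y \<noteq> 1" using assms y by (auto intro!: Nat.gr0I)
  have "\<And>r. prime r \<Longrightarrow> r dvd y \<Longrightarrow> r = T" using assms(6) y \<open>\<not> s dvd y\<close> by (metis dvd_mult)
  then obtain j where j: "y = T ^ j" using only_prime_factor_imp_power \<open>y > 0\<close> assms(3) by blast
  moreover have "j > 0" using j \<open>y \<noteq> 1\<close> by (cases j) auto
  moreover have "T \<noteq> s" using j \<open>j > 0\<close> \<open>\<not> s dvd y\<close> by auto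
  ultimately show thesis using that y by blast
qed

text \<open>Padding with primes beyond \<open>b\<close> lets all cases of at most \<open>n\<close>
  prime divisors be treated as exactly \<open>n\<close>.\<close>

lemma ex_finite_superset_primes:
  fixes A :: "nat set"
  assumes "finite A" "card A \<le> n" "\<And>p. p \<in> A \<Longrightarrow> prime p"
  obtains P where "finite P" "A \<subseteq> P" "card P = n" "\<And>p. p \<in> P \<Longrightarrow> prime p"
    "\<And>p. p \<in> P \<Longrightarrow> p \<in> A \<or> p > b"
proof -
  have "infinite ({p::nat. prime p} - ({..b} \<union> A))"
    using primes_infinite assms(1) by (intro Diff_infinite_finite) auto
  then obtain B where B: "B \<subseteq> {p::nat. prime p} - ({..b} \<union> A)" "finite B" "card B = n - card A"
    using infinite_arbitrarily_large by metis
  show thesis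
  proof (rule that[of "A \<union> B"])
    show "card (A \<union> B) = n" using B assms by (subst card_Un_disjoint) auto
  qed (use B assms in auto)
qed

section \<open>Explicit computations: cyclotomic values, finite searches and residues\<close>

lemma geometric_sum_5: "(\<Sum>i<5. x ^ i) = 1 + x + x ^ 2 + x ^ 3 + (x ^ 4 :: nat)"
  by (simp add: numeral_eq_Suc)

lemma geometric_sum_7: "(\<Sum>i<7. x ^ i) = 1 + x + x ^ 2 + x ^ 3 + x ^ 4 + x ^ 5 + (x ^ 6 :: nat)"
  by (simp add: numeral_eq_Suc)

text \<open>Substituting \<open>Q = 5 * t + 1\<close> shows that the sum is 5 modulo 25, so 5
  divides it exactly once.\<close>

lemma five_cyclotomic:
  fixes Q :: nat
  assumes "[Q = 1] (mod 5)" "Q > 1"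
  shows "5 dvd (\<Sum>i<5. Q ^ i)" "\<not> 5 * 5 dvd (\<Sum>i<5. Q ^ i)" "(\<Sum>i<5. Q ^ i) > 5"
proof -
  define t where "t = Q div 5"
  have "Q mod 5 = 1" using assms(1) by (simp add: cong_def)
  then have Q: "Q = 5 * t + 1" unfolding t_def by presburger
  define z where "z = 2 * t + 10 * t ^ 2 + 25 * t ^ 3 + 25 * t ^ 4"
  have eq: "(\<Sum>i<5. Q ^ i) = 25 * z + 5"
    unfolding geometric_sum_5 z_def Q by (simp add: power_numeral_reduce algebra_simps)
  show "5 dvd (\<Sum>i<5. Q ^ i)" "\<not> 5 * 5 dvd (\<Sum>i<5. Q ^ i)"
    unfolding eq by presburger+
  show "(\<Sum>i<5. Q ^ i) > 5"
    unfolding eq using assms(2) Q by (simp add: z_def)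
qed

text \<open>Common index range of the three searches below; \<open>14 * j + 1 \<le> 261\<close>
  allows \<open>j\<close> up to 18.\<close>

lemma lessThan_19: "{..<19::nat} = {18, 17, 16, 15, 14, 13, 12, 11, 10, 9, 8, 7, 6, 5, 4, 3, 2, 1, 0}"
  by (simp add: lessThan_nat_numeral lessThan_Suc)

lemma not_dvd_71:
  fixes r :: nat
  assumes "r mod 14 = 1" "r > 71" "r \<le> 261"
  shows "\<not> r dvd (\<Sum>i<7. 71 ^ i)" "\<not> 71 dvd (\<Sum>i<7. r ^ i)"
proof -
  obtain j where r: "r = 14 * j + 1" using assms(1) by (metis mult_div_mod_eq)
  have j: "5 < j" "j \<in> {..<19}" using assms(2,3) r by simp_all
  then have "r \<in> {85, 99, 113, 127, 141, 155, 169, 183, 197, 211, 225, 239, 253}"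
    unfolding r lessThan_19 by auto
  then show "\<not> r dvd (\<Sum>i<7. 71 ^ i)" "\<not> 71 dvd (\<Sum>i<7. r ^ i)"
    unfolding geometric_sum_7 by auto
qed

lemma not_7_times_square:
  fixes q r :: nat
  assumes "q mod 6 = 1" "q > 58" "q \<le> 111" "r mod 42 = 11 \<or> r mod 42 = 23"
  shows "1 + r + r * r \<noteq> 7 * (q * q)"
proof
  assume eq: "1 + r + r * r = 7 * (q * q)"
  have "q * q \<le> 111 * 111" using assms(3) by (intro mult_le_mono)
  \<comment> \<open>\<open>7 * 111 ^ 2 = 86247\<close> lies just below
    \<open>294 ^ 2 = 86436\<close>.\<close>
  have r294: "r < 294"
  proof (rule ccontr)
    assume "\<not> r < 294"
    then have "294 * 294 \<le> r * r" by (intro mult_le_mono) auto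
    then show False using eq \<open>q * q \<le> _\<close> by linarith
  qed
  obtain i where i: "r = 42 * i + 11 \<or> r = 42 * i + 23" using assms(4) by (metis mult_div_mod_eq)
  then have "i < 7" "i \<in> {..<19}" using r294 by auto
  then have r': "r \<in> {11, 23, 53, 65, 95, 107, 137, 149, 179, 191, 221, 233, 263, 275}"
    using i unfolding lessThan_19 by auto
  obtain j where q: "q = 6 * j + 1" using assms(1) by (metis mult_div_mod_eq)
  have "9 < j" "j \<in> {..<19}" using assms(2,3) q by simp_all
  then have "q \<in> {61, 67, 73, 79, 85, 91, 97, 103, 109}" unfolding q lessThan_19 by auto
  then show False using r' eq by auto
qed

lemma not_961_dvd:
  fixes R :: nat
  assumes "R mod 210 \<in> {11, 191}" "R > 31" "R \<le> 2016"
  shows "\<not> 961 dvd (\<Sum>i<5. R ^ i)"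
proof -
  obtain j where R: "R = 210 * j + 11 \<or> R = 210 * j + 191"
    using assms(1) by (metis insertE mult_div_mod_eq singletonD)
  then have "j < 10" "j \<in> {..<19}" using assms(3) by auto
  then have "R \<in> {191, 221, 401, 431, 611, 641, 821, 851, 1031, 1061, 1241, 1271, 1451, 1481,
      1661, 1691, 1871, 1901, 2081}"
    using R assms(2) unfolding lessThan_19 by auto
  then show ?thesis unfolding geometric_sum_5 by auto
qed

lemma mod_42_cases:
  fixes r :: nat
  assumes "r mod 3 = 2" "odd r" "r mod 7 \<in> {2, 4}"
  shows "r mod 42 = 11 \<or> r mod 42 = 23"
proof -
  have "r mod 6 = 5" using assms(1,2) by presburger
  then obtain a where a: "r = 6 * a + 5" by (metis mult_div_mod_eq)
  have "(6 * a + 5) mod 7 = 2 \<or> (6 * a + 5) mod 7 = 4" using assms(3) a by simp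
  then have "a mod 7 = 3 \<or> a mod 7 = 1" by presburger
  then obtain b where "a = 7 * b + 3 \<or> a = 7 * b + 1" by (metis mult_div_mod_eq)
  then have "r = 42 * b + 23 \<or> r = 42 * b + 11" using a by auto
  then show ?thesis by auto
qed

lemma mod_210_cases:
  fixes r :: nat
  assumes "r mod 42 = 11 \<or> r mod 42 = 23" "r mod 5 = 1"
  shows "r mod 210 \<in> {11, 191}"
  using assms(1)
proof
  assume "r mod 42 = 11"
  then obtain a where a: "r = 42 * a + 11" by (metis mult_div_mod_eq)
  have "a mod 5 = 0" using assms(2) unfolding a by presburger
  then obtain b where "a = 5 * b" by blast
  then show ?thesis using a by simp
next
  assume "r mod 42 = 23"
  then obtain a where a: "r = 42 * a + 23" by (metis mult_div_mod_eq)
  have "a mod 5 = 4" using assms(2) unfolding a by presburger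
  then obtain b where "a = 5 * b + 4" by (metis mult_div_mod_eq)
  then have "r = 210 * b + 191" using a by simp
  then show ?thesis by simp
qed

text \<open>2 and 4 are the primitive cube roots of unity modulo 7.\<close>

lemma seven_dvd_cyclotomic_3:
  fixes r :: nat
  assumes "r mod 7 \<in> {2, 4}"
  shows "7 dvd 1 + r + r * r"
proof -
  obtain a where "r = 7 * a + 2 \<or> r = 7 * a + 4"
    using assms by (metis insertE mult_div_mod_eq singletonD)
  then have "1 + r + r * r = 7 * (1 + 5 * a + 7 * a * a) \<or> 1 + r + r * r = 7 * (3 + 9 * a + 7 * a * a)"
    by (auto simp: algebra_simps)
  then show ?thesis by (metis dvd_triv_left)
qed

section \<open>Odd numbers of abundancy 7/5\<close>

text \<open>This is the situation of half a friend of 20: the factor 2 has abundancy 3/2, and 21/10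
  divided by 3/2 is 7/5.\<close>

locale half_friend =
  fixes k :: nat
  assumes odd_k: "odd k" and sigma_eq: "5 * divisor_sigma k = 7 * k"
begin

lemma k_pos: "k > 0"
  using odd_k by (cases k) auto

lemma even_multiplicity: "prime p \<Longrightarrow> even (multiplicity p k)"
proof (rule odd_divisor_sigma_imp_even_multiplicity[OF odd_k])
  have "odd (5 * divisor_sigma k)" using odd_k unfolding sigma_eq by simp
  then show "odd (divisor_sigma k)" by simp
qed

lemma divisor_bound:
  assumes "d dvd k"
  shows "5 * divisor_sigma d \<le> 7 * d"
proof -
  obtain c where c: "k = d * c" using assms by blast
  have "d > 0" "c > 0" using k_pos c by (auto intro!: Nat.gr0I)
  then have "5 * divisor_sigma d * c \<le> 7 * d * c"
    using divisor_sigma_mult_le(1)[of d c] sigma_eq unfolding c by linarith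
  then show ?thesis using \<open>c > 0\<close> by simp
qed

lemma upper_bound:
  assumes "finite P" "\<And>p. p \<in> P \<Longrightarrow> prime p" "prime_factors k \<subseteq> P"
  shows "7 * (\<Prod>p\<in>P. p - 1) \<le> 5 * \<Prod>P"
proof -
  have "5 * divisor_sigma k * (\<Prod>p\<in>P. p - 1) \<le> 5 * (k * \<Prod>P)"
    using divisor_sigma_prod_upper[OF k_pos assms] by simp
  then have "k * (7 * (\<Prod>p\<in>P. p - 1)) \<le> k * (5 * \<Prod>P)"
    unfolding sigma_eq by (simp add: ac_simps)
  then show ?thesis using k_pos by simp
qed

lemma five_dvd: "5 dvd k"
proof -
  have "5 dvd 7 * k" using sigma_eq by (metis dvd_triv_left)
  moreover have "coprime 5 (7::nat)" by (simp add: primes_coprime)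
  ultimately show ?thesis using coprime_dvd_mult_right_iff by blast
qed

text \<open>Multiplicities in \<open>k\<close> are even, so a prime divisor has multiplicity 2 or at
  least 4.\<close>

lemma prime_power_dvd:
  assumes "prime p" "p dvd k"
  shows "p ^ 2 dvd k" and "multiplicity p k \<noteq> 2 \<Longrightarrow> p ^ 4 dvd k"
proof -
  have e: "multiplicity p k > 0" "even (multiplicity p k)"
    using assms k_pos even_multiplicity by (auto simp: prime_multiplicity_gt_zero_iff)
  then have "2 \<le> multiplicity p k" by presburger
  then show "p ^ 2 dvd k" by (rule multiplicity_dvd')
  assume "multiplicity p k \<noteq> 2"
  then have "4 \<le> multiplicity p k" using e by presburger
  then show "p ^ 4 dvd k" by (rule multiplicity_dvd')
qed

text \<open>This is \<open>divisor_bound\<close> for \<open>5 ^ 2 * p ^ 2\<close>: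
  \<open>155 = 5 * 31\<close> with \<open>31 = 1 + 5 + 25\<close>, and
  \<open>175 = 7 * 25\<close>.\<close>

lemma two_prime_bound:
  assumes "prime p" "p dvd k" "p \<noteq> 5"
  shows "155 * (1 + p + p ^ 2) \<le> 175 * p ^ 2"
proof -
  have 5: "prime (5::nat)" by simp
  have cop: "coprime (5 ^ 2) (p ^ 2)"
    using primes_coprime[OF 5 assms(1)] assms(3) coprime_power_left_iff coprime_power_right_iff by blast
  have "5 ^ 2 * p ^ 2 dvd k"
    using divides_mult prime_power_dvd(1) assms five_dvd 5 cop by blast
  then have "5 * divisor_sigma (5 ^ 2 * p ^ 2) \<le> 7 * (5 ^ 2 * p ^ 2)" by (rule divisor_bound)
  then show ?thesis
    by (simp add: divisor_sigma_mult_coprime[OF cop, simplified] divisor_sigma_prime_square[OF assms(1)]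
        divisor_sigma_prime_square[OF 5, simplified])
qed

text \<open>The preceding bound fails at both primes: 2015 > 1575 for 3 and 8835 > 8575 for
  7.\<close>

lemma not_dvd_3: "\<not> 3 dvd k" and not_dvd_7: "\<not> 7 dvd k"
  using two_prime_bound[of 3] two_prime_bound[of 7] by (auto simp: power2_eq_square)

lemma geometric_sum_dvd_7k:
  assumes "prime p" "p dvd k" "s dvd multiplicity p k + 1"
  shows "(\<Sum>i<s. p ^ i) dvd 7 * k"
proof -
  have "(\<Sum>i<s. p ^ i) dvd (\<Sum>i\<le>multiplicity p k. p ^ i)"
    using geometric_sum_dvd[OF assms(3)] prime_gt_1_nat[OF assms(1)]
    by (simp add: lessThan_Suc_atMost)
  also have "\<dots> dvd divisor_sigma k"
    using divisor_sigma_prime_power_dvd k_pos assms by blast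
  also have "\<dots> dvd 7 * k"
    using sigma_eq by (metis dvd_triv_right)
  finally show ?thesis .
qed

lemma prime_dvd_7k:
  assumes "prime r" "r dvd 7 * k"
  shows "r = 7 \<or> r dvd k"
proof -
  have "r dvd 7 \<or> r dvd k" using assms prime_dvd_mult_nat by blast
  then show ?thesis using assms(1) primes_dvd_imp_eq[of r 7] by auto
qed

lemma square_7_not_dvd: "\<not> 49 dvd 7 * k"
  using not_dvd_7 by presburger

text \<open>Since 25 divides \<open>7 * k\<close>, 5 divides \<open>divisor_sigma k\<close> and
  hence some geometric sum of odd length \<open>n\<close>. The order of \<open>p\<close> modulo 5
  divides both 4 and \<open>n\<close>, so it is 1; then the sum is \<open>n\<close> modulo 5 and 5
  divides \<open>n\<close>.\<close>

lemma source_5: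
  obtains Q where "prime Q" "Q dvd k" "[Q = 1] (mod 5)" "(\<Sum>i<5. Q ^ i) dvd 7 * k"
proof -
  have "5 ^ 2 dvd k" using prime_power_dvd(1)[OF _ five_dvd] by simp
  then have "25 dvd 5 * divisor_sigma k" unfolding sigma_eq by simp
  then have "5 dvd divisor_sigma k" by presburger
  then obtain p where p: "prime p" "p dvd k" "5 dvd (\<Sum>i\<le>multiplicity p k. p ^ i)"
    using prime_dvd_divisor_sigmaE[OF k_pos, of 5] by auto
  define n where "n = Suc (multiplicity p k)"
  have s: "5 dvd (\<Sum>i<n. p ^ i)" using p(3) by (simp add: n_def lessThan_Suc_atMost)
  have o: "odd n" using even_multiplicity[OF p(1)] by (simp add: n_def)
  have c: "[p ^ n = 1] (mod 5)" using dvd_geometric_sum_imp_cong[OF s] prime_gt_0_nat[OF p(1)] by simp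
  have "coprime p 5"
  proof -
    have "coprime (p ^ n) 5" using c by (metis cong_imp_coprime cong_sym coprime_1_left)
    then show ?thesis by (simp add: n_def)
  qed
  then have "[p ^ 4 = 1] (mod 5)" using euler_theorem[of p 5] by (simp add: totient_prime)
  then have "ord 5 p dvd 4" "ord 5 p dvd n" using c ord_divides by blast+
  moreover have "coprime n 4" using o coprime_power_right_iff[of n 2 2] by simp
  ultimately have "ord 5 p = 1" by (metis coprime_common_divisor_nat nat_dvd_1_iff_1)
  then have p1: "[p = 1] (mod 5)" by (metis ord power_one_right)
  have "5 dvd n" using geometric_sum_mod_one[OF p1, of n] s cong_dvd_iff by blast
  then show thesis
    using that[OF p(1,2) p1] geometric_sum_dvd_7k[OF p(1,2), of 5] by (simp add: n_def)
qed

text \<open>As for 5, but the order of \<open>p\<close> modulo 7 divides 6 and an odd length, so it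
  is 1 or 3. Order 3 forces residue 2 or 4, and \<open>p mod 3 = 1\<close> would make 3 divide
  \<open>1 + p + p ^ 2\<close> and hence \<open>k\<close>.\<close>

lemma source_7:
  obtains (one) p where "prime p" "p dvd k" "[p = 1] (mod 7)" "(\<Sum>i<7. p ^ i) dvd 7 * k"
  | (three) p where "prime p" "p dvd k" "p mod 7 \<in> {2, 4}" "p mod 3 = 2" "1 + p + p ^ 2 dvd 7 * k"
proof -
  have "coprime 7 (5::nat)" by (simp add: primes_coprime)
  moreover have "7 dvd 5 * divisor_sigma k" unfolding sigma_eq by simp
  ultimately have "7 dvd divisor_sigma k" using coprime_dvd_mult_right_iff by blast
  then obtain p where p: "prime p" "p dvd k" "7 dvd (\<Sum>i\<le>multiplicity p k. p ^ i)"
    using prime_dvd_divisor_sigmaE[OF k_pos, of 7] by auto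
  define n where "n = Suc (multiplicity p k)"
  have s: "7 dvd (\<Sum>i<n. p ^ i)" using p(3) by (simp add: n_def lessThan_Suc_atMost)
  have o: "odd n" using even_multiplicity[OF p(1)] by (simp add: n_def)
  have c: "[p ^ n = 1] (mod 7)" using dvd_geometric_sum_imp_cong[OF s] prime_gt_0_nat[OF p(1)] by simp
  have "coprime p 7"
  proof -
    have "coprime (p ^ n) 7" using c by (metis cong_imp_coprime cong_sym coprime_1_left)
    then show ?thesis by (simp add: n_def)
  qed
  then have "[p ^ 6 = 1] (mod 7)" using euler_theorem[of p 7] by (simp add: totient_prime)
  then have d: "ord 7 p dvd 2 * 3" "ord 7 p dvd n" using c ord_divides by force+
  moreover have "coprime (ord 7 p) 2" using d(2) o dvd_trans by auto
  ultimately have "ord 7 p dvd 3" using coprime_dvd_mult_right_iff by blast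
  moreover have "prime (3::nat)" by simp
  ultimately consider "ord 7 p = 1" | "ord 7 p = 3" unfolding prime_nat_iff by blast
  then show thesis
  proof cases
    case 1
    then have p1: "[p = 1] (mod 7)" by (metis ord power_one_right)
    have "7 dvd n" using geometric_sum_mod_one[OF p1, of n] s cong_dvd_iff by blast
    then show thesis
      using one[OF p(1,2) p1] geometric_sum_dvd_7k[OF p(1,2), of 7] by (simp add: n_def)
  next
    case 2
    then have p3: "[p ^ 3 = 1] (mod 7)" by (metis ord)
    have p1: "\<not> [p = 1] (mod 7)" using 2 ord_divides[of p 1 7] by simp
    have "3 dvd n" using d(2) 2 by simp
    then have "(\<Sum>i<3. p ^ i) dvd 7 * k" 
      using geometric_sum_dvd_7k[OF p(1,2), of 3] by (simp add: n_def)
    then have div: "1 + p + p ^ 2 dvd 7 * k" by (simp add: numeral_eq_Suc)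
    have "p mod 7 \<in> {0, 1, 2, 3, 4, 5, 6}" by auto
    moreover have "(p mod 7) ^ 3 mod 7 = 1" using p3 by (simp add: cong_def power_mod)
    ultimately have p7: "p mod 7 \<in> {2, 4}" using p1 by (auto simp: cong_def)
    have "p mod 3 \<noteq> 0" using not_dvd_3 p(2) by (metis dvd_trans mod_eq_0_iff_dvd)
    moreover have "p mod 3 \<noteq> 1"
    proof
      assume "p mod 3 = 1"
      then obtain j where "p = 3 * j + 1" by (metis mult_div_mod_eq)
      then have "1 + p + p ^ 2 = 3 * (1 + 3 * j + 3 * j ^ 2)"
        by (simp add: power2_eq_square algebra_simps)
      then have "3 dvd 7 * k" using div dvd_trans dvd_triv_left by metis
      then show False using not_dvd_3 by presburger
    qed
    ultimately have "p mod 3 = 2" by presburger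
    then show thesis using three[OF p(1,2) p7] div by simp
  qed
qed

lemma cyclotomic_prime_dvd_k:
  assumes "prime s" "prime p" "(\<Sum>i<s. p ^ i) dvd 7 * k" "prime r" "r dvd (\<Sum>i<s. p ^ i)"
  shows "r = 7 \<or> r dvd k" "r = s \<or> [r = 1] (mod s)" "r \<noteq> p"
proof -
  have "r dvd 7 * k" using assms(3,5) by (rule dvd_trans[rotated])
  then show "r = 7 \<or> r dvd k" by (rule prime_dvd_7k[OF assms(4)])
  show "r = s \<or> [r = 1] (mod s)"
    by (rule prime_dvd_cyclotomic[OF assms(1,4,5) prime_gt_0_nat[OF assms(2)]])
  show "r \<noteq> p"
    using not_dvd_geometric_sum[OF prime_gt_1_nat[OF assms(2)] prime_gt_0_nat[OF assms(1)]] assms(5) by blast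
qed

text \<open>The sum attached to \<open>Q\<close> exceeds 5 and contains 5 only once, so it has
  another prime divisor, which is 1 modulo 5 and differs from \<open>Q\<close> because the sum is 1
  modulo \<open>Q\<close>.\<close>

lemma second_prime_5:
  obtains Q R where "prime Q" "Q dvd k" "[Q = 1] (mod 5)" "prime R" "R dvd k" "[R = 1] (mod 5)" "R \<noteq> Q"
proof -
  obtain Q where Q: "prime Q" "Q dvd k" "[Q = 1] (mod 5)" "(\<Sum>i<5. Q ^ i) dvd 7 * k"
    by (rule source_5)
  have "prime (5::nat)" by simp
  note five = this five_cyclotomic[OF Q(3) prime_gt_1_nat[OF Q(1)]]
  obtain R where R: "prime R" "R dvd (\<Sum>i<5. Q ^ i)" "R \<noteq> 5"
    using not_square_dvd_imp_other_prime[OF five(1,4,3)] .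
  note * = cyclotomic_prime_dvd_k[OF five(1) Q(1,4) R(1,2)]
  then have R1: "[R = 1] (mod 5)" using R by auto
  then have "R \<noteq> 7" by (auto simp: cong_def)
  then show thesis using that Q R R1 * by blast
qed

lemma second_prime_7:
  assumes "prime p" "[p = 1] (mod 7)" "(\<Sum>i<7. p ^ i) dvd 7 * k"
  obtains r where "prime r" "r dvd k" "r dvd (\<Sum>i<7. p ^ i)" "[r = 1] (mod 7)" "r \<noteq> p"
proof -
  have 7: "prime (7::nat)" by simp
  have "p \<noteq> 1" "p mod 7 = 1" using assms by (auto simp: cong_def)
  then have "7 < p" using assms(1) prime_gt_1_nat[of p] by presburger
  also have "p < (\<Sum>i<7. p ^ i)" using prime_gt_0_nat[OF assms(1)] by (simp add: geometric_sum_7)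
  finally have "(\<Sum>i<7. p ^ i) > 7" .
  moreover have "\<not> 7 * 7 dvd (\<Sum>i<7. p ^ i)"
    using assms(3) square_7_not_dvd dvd_trans by fastforce
  ultimately obtain r where r: "prime r" "r dvd (\<Sum>i<7. p ^ i)" "r \<noteq> 7"
    using not_square_dvd_imp_other_prime[OF 7] by blast
  then show thesis using cyclotomic_prime_dvd_k[OF 7 assms(1,3) r(1,2)] r that by blast
qed

lemma three_prime_bound:
  assumes "prime p" "p dvd k" "p \<noteq> 5" "p \<noteq> 11" "5 ^ a dvd k" "11 ^ b dvd k"
  shows "5 * ((\<Sum>i\<le>a. 5 ^ i) * (\<Sum>i\<le>b. 11 ^ i) * (1 + p + p ^ 2)) \<le> 7 * (5 ^ a * 11 ^ b * p ^ 2)"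
proof -
  have 5: "prime (5::nat)" and 11: "prime (11::nat)" by simp_all
  have c1: "coprime (5 ^ a) ((11::nat) ^ b)"
    using primes_coprime[OF 5 11] coprime_power_left_iff coprime_power_right_iff by simp
  have c2: "coprime (5 ^ a * 11 ^ b) (p ^ 2)"
    using primes_coprime[OF 5 assms(1)] primes_coprime[OF 11 assms(1)] assms(3,4) by (simp add: coprime_mult_left_iff)
  have "5 ^ a * 11 ^ b * p ^ 2 dvd k"
    using divides_mult c1 c2 assms(5,6) prime_power_dvd(1)[OF assms(1,2)] by blast
  from divisor_bound[OF this]
  show ?thesis
    by (simp only: divisor_sigma_prime_square[OF assms(1)] divisor_sigma_mult_coprime[OF c2] divisor_sigma_mult_coprime[OF c1]
        divisor_sigma_prime_power[OF 5] divisor_sigma_prime_power[OF 11])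
qed

end

context half_friend
begin

text \<open>Exponent 2 at 5 would bring in 31, and exponent 2 at 11 would bring in 19 through
  \<open>133 = 7 * 19\<close>; both make the abundancy too large. So \<open>5 ^ 4\<close> and
  \<open>11 ^ 4\<close> divide \<open>k\<close>, leaving very little room for
  \<open>p\<close>.\<close>

lemma eleven_dvd_imp_ge_59:
  assumes "11 dvd k" "prime p" "p dvd k" "p \<noteq> 5" "p \<noteq> 11"
  shows "p \<ge> 59"
proof -
  have 5: "prime (5::nat)" and 11: "prime (11::nat)" by simp_all
  have sq: "5 ^ 2 dvd k" "11 ^ 2 dvd k" 
    using prime_power_dvd(1)[OF 5 five_dvd] prime_power_dvd(1)[OF 11 assms(1)] .
  have s2: "(\<Sum>i\<le>2. 5 ^ i) = (31::nat)" "(\<Sum>i\<le>2. 11 ^ i) = (133::nat)"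
    by (simp_all add: atMost_nat_numeral)
  have s4: "(\<Sum>i\<le>4. 5 ^ i) = (781::nat)" "(\<Sum>i\<le>4. 11 ^ i) = (16105::nat)"
    by (simp_all add: atMost_nat_numeral)
  have s3: "(\<Sum>i<3. 5 ^ i) = (31::nat)" "(\<Sum>i<3. 11 ^ i) = (133::nat)"
    by (simp_all add: lessThan_nat_numeral)
  have no: "\<not> 31 dvd k" "\<not> 19 dvd k"
    using three_prime_bound[of 31 2 2] three_prime_bound[of 19 2 2] sq by (auto simp: s2)
  have "multiplicity 5 k \<noteq> 2"
  proof
    assume "multiplicity 5 k = 2"
    then have "31 dvd 7 * k" using geometric_sum_dvd_7k[OF 5 five_dvd, of 3] by (simp add: s3)
    then show False using prime_dvd_7k[of 31] no by auto
  qed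
  then have "5 ^ 4 dvd k" by (rule prime_power_dvd(2)[OF 5 five_dvd])
  have "multiplicity 11 k \<noteq> 2"
  proof
    assume "multiplicity 11 k = 2"
    then have "133 dvd 7 * k" using geometric_sum_dvd_7k[OF 11 assms(1), of 3] by (simp add: s3)
    then have "19 dvd 7 * k" using dvd_trans[of 19 133 "7 * k"] by simp
    then show False using prime_dvd_7k[of 19] no by auto
  qed
  then have "11 ^ 4 dvd k" by (rule prime_power_dvd(2)[OF 11 assms(1)])
  from three_prime_bound[OF assms(2-5) \<open>5 ^ 4 dvd k\<close> this]
  have le: "62890025 * (1 + p + p * p) \<le> 64054375 * (p * p)"
    by (simp add: s4 power2_eq_square)
  \<comment> \<open>The coefficients differ by 1164350, and \<open>54 * 1164350 = 62874900\<close>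
    is still below 62890025.\<close>
  have "p > 54"
  proof (rule ccontr)
    assume "\<not> p > 54"
    then have "p * p \<le> 54 * p" by (intro mult_right_mono) auto
    moreover have "\<lbrakk>62890025 * (1 + p + z) \<le> 64054375 * z; z \<le> 54 * p\<rbrakk> \<Longrightarrow> False" for z :: nat
      by simp
    ultimately show False using le by blast
  qed
  moreover have "p \<noteq> 55" "p \<noteq> 56" "p \<noteq> 57" "p \<noteq> 58" using assms(2) by auto
  ultimately show ?thesis by linarith
qed

end

section \<open>Excluding at most four prime divisors\<close>

text \<open>The prime divisors of \<open>k\<close>, padded to exactly four elements by huge primes.\<close>

locale few_primes = half_friend +
  fixes P :: "nat set"
  assumes finite_P: "finite P" and card_P: "card P = 4"
    and prime_P: "p \<in> P \<Longrightarrow> prime p"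
    and prime_dvd_P: "prime p \<Longrightarrow> p dvd k \<Longrightarrow> p \<in> P"
    and P_dvd: "p \<in> P \<Longrightarrow> p dvd k \<or> p > 10000"
begin

lemma five_in_P: "5 \<in> P"
  using prime_dvd_P five_dvd by simp

lemma P_cases:
  assumes "p \<in> P" shows "p = 5 \<or> p \<ge> 11" "odd p"
proof -
  have p: "prime p" "p \<noteq> 2" "p \<noteq> 3" "p \<noteq> 7"
    using P_dvd[OF assms] prime_P[OF assms] odd_k not_dvd_3 not_dvd_7 by auto
  then have "p \<noteq> 0" "p \<noteq> 1" "p \<noteq> 4" "p \<noteq> 6" "p \<noteq> 8" "p \<noteq> 9" "p \<noteq> 10" by auto
  then show "p = 5 \<or> p \<ge> 11" using p by presburger
  show "odd p" using p primes_dvd_imp_eq[of 2 p] by auto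
qed

text \<open>The prime 5 contributes the factors in \<open>28 = 7 * 4\<close> and
  \<open>25 = 5 * 5\<close>. Integers are used because the bound is later rearranged into products
  of differences.\<close>

lemma P_bound:
  assumes "P = {5, a, b, c}"
  shows "28 * ((int a - 1) * (int b - 1) * (int c - 1)) \<le> 25 * (int a * int b * int c)"
proof -
  have d: "5 \<noteq> a" "5 \<noteq> b" "5 \<noteq> c" "a \<noteq> b" "a \<noteq> c" "b \<noteq> c"
    using card_P unfolding assms by (auto simp: card_insert_if split: if_splits)
  have pos: "a > 0" "b > 0" "c > 0" using prime_P assms prime_gt_0_nat by auto
  have "prime_factors k \<subseteq> P" using prime_dvd_P by auto
  then have "7 * (\<Prod>p\<in>P. p - 1) \<le> 5 * \<Prod>P"
    using upper_bound finite_P prime_P by blast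
  then have "28 * ((a - 1) * (b - 1) * (c - 1)) \<le> 25 * (a * b * c)"
    unfolding assms using d by (simp add: ac_simps)
  then have "int (28 * ((a - 1) * (b - 1) * (c - 1))) \<le> int (25 * (a * b * c))"
    by (rule zle_int[THEN iffD2])
  then show ?thesis using pos by (simp add: of_nat_diff)
qed

lemma cyclotomic_prime_in_P:
  assumes "prime s" "p \<in> P" "(\<Sum>i<s. p ^ i) dvd 7 * k" "prime r" "r dvd (\<Sum>i<s. p ^ i)"
  shows "r = 7 \<or> r \<in> P" "r = s \<or> r mod s = 1" "r \<noteq> p"
  using cyclotomic_prime_dvd_k[OF assms(1) prime_P[OF assms(2)] assms(3-5)] prime_dvd_P[OF assms(4)]
    prime_gt_1_nat[OF assms(1)]
  by (auto simp: cong_def)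

lemma P_remaining:
  assumes "finite A" "A \<subseteq> P" "card A = 2"
  obtains q r where "P = A \<union> {q, r}" "q < r" "q \<notin> A" "r \<notin> A"
proof -
  have "card (P - A) = 2" using assms card_P by (simp add: card_Diff_subset)
  then obtain q r where qr: "P - A = {q, r}" "q \<noteq> r" by (auto simp: card_2_iff)
  then have "P = A \<union> {q, r}" "P = A \<union> {r, q}" "q \<notin> A" "r \<notin> A" using assms(2) by blast+
  then show thesis using that qr(2) by (metis linorder_neqE_nat)
qed

lemma P_cyclotomic_3:
  assumes "S \<in> P" "1 + S + S * S dvd 7 * k" "prime y" "y dvd 1 + S + S * S"
  shows "y = 7 \<or> y \<in> P" "y mod 3 = 1" "y \<noteq> S"
proof -
  have s: "1 + S + S * S = (\<Sum>i<3. S ^ i)" by (simp add: numeral_eq_Suc)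
  have "prime (3::nat)" by simp
  note y = cyclotomic_prime_in_P[OF this assms(1) assms(2)[unfolded s] assms(3) assms(4)[unfolded s]]
  then show "y = 7 \<or> y \<in> P" "y \<noteq> S" by blast+
  have "3 \<notin> P" using P_cases[of 3] by auto
  then show "y mod 3 = 1" using y by auto
qed

lemma not_eleven_dvd: "\<not> 11 dvd k"
proof
  assume 11: "11 dvd k"
  then have "11 \<in> P" using prime_dvd_P by simp
  then obtain q r where P: "P = {5, 11} \<union> {q, r}" "q < r" "q \<notin> {5, 11}" "r \<notin> {5, 11}"
    using P_remaining[of "{5, 11}"] five_in_P by auto
  have ge: "q \<ge> 59" "r \<ge> 59"
    using eleven_dvd_imp_ge_59[OF 11, of q] P_dvd[of q] prime_P[of q]
      eleven_dvd_imp_ge_59[OF 11, of r] P_dvd[of r] prime_P[of r] P by auto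
  have pr: "prime q" "prime r" "odd q" "odd r" using prime_P P_cases(2) P by auto
  have "P = {5, 11, q, r}" using P by auto
  from P_bound[OF this]
  have B: "(int q - 56) * (int r - 56) \<le> 3080" by (simp add: algebra_simps)
  have q111: "q \<le> 111"
  proof (rule ccontr)
    assume "\<not> q \<le> 111"
    then have "56 * 57 \<le> (int q - 56) * (int r - 56)" using P(2) by (intro mult_mono) auto
    then show False using B by simp
  qed
  have "3 * (int r - 56) \<le> (int q - 56) * (int r - 56)" using ge by (intro mult_right_mono) auto
  then have r1082: "r \<le> 1082" using B by simp
  show False
  proof (cases rule: source_7)
    case (one p)
    obtain p' where p': "prime p'" "p' dvd k" "p' dvd (\<Sum>i<7. p ^ i)" "[p' = 1] (mod 7)" "p' \<noteq> p"
      using second_prime_7[OF one(1,3,4)] .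
    have m: "p mod 7 = 1" "p' mod 7 = 1" using one p' by (auto simp: cong_def)
    have "p \<in> P" "p' \<in> P" using one p' prime_dvd_P by auto
    then have pp: "p = q \<and> p' = r \<or> p = r \<and> p' = q" using m p'(5) P(1) by auto
    then have m7: "q mod 7 = 1" "r mod 7 = 1" using m by auto
    have m14: "q mod 14 = 1" "r mod 14 = 1" using m7 pr by presburger+
    obtain j where j: "q = 14 * j + 1" using m14(1) by (metis mult_div_mod_eq)
    \<comment> \<open>Between 59 and 111 this leaves 71, 85 and 99.\<close>
    have "j = 5 \<or> j = 6 \<or> j = 7" using j ge q111 by presburger
    moreover have "\<not> prime (85::nat)" "\<not> prime (99::nat)" by simp_all
    ultimately have q: "q = 71" using j pr(1) by auto
    then have "r \<le> 261" "r > 71" using B P(2) by auto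
    from not_dvd_71[OF m14(2) this(2,1)] show False using p'(3) pp q by auto
  next
    case (three S)
    have x: "1 + S + S * S dvd 7 * k" using three(5) by (simp add: power2_eq_square)
    have S: "S \<in> P" using prime_dvd_P three by blast
    have "S \<noteq> 5" using three(3) by auto
    moreover have "S \<noteq> 11"
    proof
      assume "S = 11"
      then have "19 dvd 7 * k" using dvd_trans[of 19 "1 + S + S * S" "7 * k"] x by simp
      then have "19 dvd k" using prime_dvd_7k[of 19] by simp
      then show False using eleven_dvd_imp_ge_59[OF 11, of 19] by simp
    qed
    ultimately have Sqr: "S = q \<or> S = r" using S P(1) by auto
    have m42: "S mod 42 = 11 \<or> S mod 42 = 23"
      using mod_42_cases[OF three(4) P_cases(2)[OF S] three(3)] .
    \<comment> \<open>5 and 11 are 2 modulo 3, so besides 7 only the partner of \<open>S\<close> in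
      \<open>{q, r}\<close> can divide.\<close>
    have other: "y = 7 \<or> y = (if S = q then r else q) \<and> y mod 3 = 1"
      if "prime y" "y dvd 1 + S + S * S" for y
      using P_cyclotomic_3[OF S x that] P(1) Sqr by auto
    from Sqr show False
    proof
      assume Sq: "S = q"
      obtain i where i: "q = 42 * i + 11 \<or> q = 42 * i + 23" using m42 Sq by (metis mult_div_mod_eq)
      then have "i = 1 \<or> i = 2" using ge q111 by auto
      moreover have "\<not> prime (65::nat)" "\<not> prime (95::nat)" by simp_all
      ultimately have "q = 107" using i pr ge q111 by auto
      \<comment> \<open>\<open>1 + 107 + 107 ^ 2 = 7 * 13 * 127\<close>, and 13 is neither 7 nor
        \<open>r\<close>.\<close>
      then show False using other[of 13] Sq P(2) by simp
    next
      assume Sr: "S = r"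
      \<comment> \<open>The goal is \<open>1 + r + r * r = 7 * q ^ j\<close>. Then
        \<open>j = 1\<close> makes the right side too small, \<open>j = 2\<close> is excluded by the
        finite search, and \<open>j \<ge> 3\<close> makes it at least \<open>7 * 59 ^ 3\<close>,
        which exceeds \<open>1 + 1082 + 1082 ^ 2\<close>.\<close>
      have "59 * 59 \<le> r * r" using ge by (intro mult_le_mono) auto
      then have "1 + r + r * r > 7" by simp
      moreover have "7 dvd 1 + r + r * r" using seven_dvd_cyclotomic_3 three(3) Sr by blast
      moreover have "\<not> 7 * 7 dvd 1 + r + r * r"
        using dvd_trans[OF _ x, of 49] square_7_not_dvd Sr by auto
      ultimately obtain j where j: "1 + r + r * r = 7 * q ^ j" "j > 0"
        using two_prime_factors_imp[of 7 "1 + r + r * r" q] other pr(1) Sr P(2) by auto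
      have "q dvd 1 + S + S * S" unfolding Sr j(1) using j(2) by simp
      then have "q mod 3 = 1" using other[OF pr(1)] ge P(2) Sr by auto
      then have q6: "q mod 6 = 1" using pr(3) by presburger
      have "j \<noteq> 1"
      proof
        assume "j = 1"
        then have "1 + r + r * r = 7 * q" using j(1) by simp
        moreover have "59 * r \<le> r * r" using ge by (intro mult_le_mono) auto
        ultimately show False using P(2) by linarith
      qed
      moreover have "j \<noteq> 2"
        using j(1) not_7_times_square[OF q6 _ q111, of r] ge m42 Sr by (auto simp: power2_eq_square)
      ultimately have "3 \<le> j" using j(2) by linarith
      then have "q ^ 3 \<le> q ^ j" using ge by (intro power_increasing) auto
      moreover have "59 ^ 3 \<le> q ^ 3" using ge by (intro power_mono) auto
      moreover have "r * r \<le> 1082 * 1082" using r1082 by (intro mult_le_mono)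
      ultimately show False using j(1) r1082 by simp
    qed
  qed
qed

lemma few_primes_impossible: False
proof -
  have ge13: "p = 5 \<or> p \<ge> 13" if "p \<in> P" for p
  proof -
    have "p \<noteq> 11" using P_dvd[OF that] not_eleven_dvd by auto
    then show ?thesis using P_cases[OF that] by presburger
  qed
  obtain Q R where QR: "Q \<in> P" "R \<in> P" "Q mod 5 = 1" "R mod 5 = 1" "Q < R"
  proof -
    obtain Q R where h: "prime Q" "Q dvd k" "[Q = 1] (mod 5)" "prime R" "R dvd k" "[R = 1] (mod 5)" "R \<noteq> Q"
      by (rule second_prime_5)
    then have "Q \<in> P" "R \<in> P" "Q mod 5 = 1" "R mod 5 = 1"
      using prime_dvd_P by (auto simp: cong_def)
    then show thesis using that[of Q R] that[of R Q] h(7) by linarith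
  qed
  have "Q \<noteq> 5" "R \<noteq> 5" using QR by auto
  obtain a b where ab: "P = {Q, R} \<union> {a, b}" "a < b" "a \<notin> {Q, R}" "b \<notin> {Q, R}"
    using P_remaining[of "{Q, R}"] QR by auto
  have "a = 5 \<or> b = 5" using five_in_P ab \<open>Q \<noteq> 5\<close> \<open>R \<noteq> 5\<close> by auto
  then obtain t where t: "P = {5, t, Q, R}" "t \<noteq> 5" using ab by blast
  have ge: "t \<ge> 13" "Q \<ge> 13" "R \<ge> 13"
    using ge13 t QR \<open>Q \<noteq> 5\<close> \<open>R \<noteq> 5\<close> by auto
  have pr: "prime t" "prime Q" "odd Q" "odd R" using prime_P P_cases(2) t by auto
  have "n mod 10 = 1" if "n mod 5 = 1" "odd n" for n :: nat
    using that by presburger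
  then have m10: "Q mod 10 = 1" "R mod 10 = 1" using QR(3,4) pr(3,4) by blast+
  have "Q \<noteq> 21" using pr(2) by auto
  then have Q31: "Q \<ge> 31" using m10(1) ge(2) by presburger
  then have "R > 31" using QR(5) by linarith
  then have R41: "R \<ge> 41" using m10(2) by presburger
  note B = P_bound[OF t(1)]
  have "t < 19"
  \<comment> \<open>If all three primes are at least 19, 31 and 41, the product of the
    \<open>p / (p - 1)\<close> is at most \<open>19/18 * 31/30 * 41/40 = 24149/21600\<close>, just
    below 28/25.\<close>
  proof (rule ccontr)
    assume "\<not> t < 19"
    then have "(18 * int t) * (30 * int Q) \<le> (19 * (int t - 1)) * (31 * (int Q - 1))"
      using Q31 by (intro mult_mono[of "18 * int t"]) simp_all
    then have "((18 * int t) * (30 * int Q)) * (40 * int R)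
        \<le> ((19 * (int t - 1)) * (31 * (int Q - 1))) * (41 * (int R - 1))"
      by (rule mult_mono) (use R41 Q31 \<open>\<not> t < 19\<close> in simp_all)
    moreover have "18 * x * (30 * y) * (40 * z) = 21600 * (x * y * z)"
        "19 * x * (31 * y) * (41 * z) = 24149 * (x * y * z)" for x y z :: int
      by simp_all
    ultimately have "21600 * (int t * int Q * int R) \<le> 24149 * ((int t - 1) * (int Q - 1) * (int R - 1))"
      by metis
    moreover have "int t * int Q * int R > 0" using ge by simp
    moreover have "\<lbrakk>21600 * x \<le> 24149 * y; x > 0; 28 * y \<le> 25 * x\<rbrakk> \<Longrightarrow> False" for x y :: int
      by simp
    ultimately show False using B by blast
  qed
  moreover have "t \<noteq> 14" "t \<noteq> 15" "t \<noteq> 16" "t \<noteq> 18" using pr(1) by auto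
  ultimately have "t = 17 \<or> t = 13" using ge(1) by presburger
  then show False
  proof
    assume t17: "t = 17"
    \<comment> \<open>From \<open>448 * (Q - 1) * (R - 1) \<le> 425 * Q * R\<close>, multiplied by
      \<open>23 = 448 - 425\<close> so that it factors.\<close>
    have B: "(23 * int Q - 448) * (23 * int R - 448) \<le> 190400"
      using B t17 by (simp add: algebra_simps)
    have "Q \<le> 38"
    proof (rule ccontr)
      assume "\<not> Q \<le> 38"
      then have "449 * 472 \<le> (23 * int Q - 448) * (23 * int R - 448)"
        using QR(5) by (intro mult_mono) auto
      then show False using B by simp
    qed
    then have Q: "Q = 31" using Q31 m10(1) by presburger
    then have "R \<le> 50" using B by simp
    then have R: "R = 41" using R41 m10(2) by presburger
    \<comment> \<open>The primes are now 5, 17, 31, 41, whereas \<open>source_7\<close> requires a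
      residue 1, 2 or 4.\<close>
    have mods: "p mod 7 \<in> {3, 5, 6}" if "p \<in> P" for p
      using that t(1) Q R t17 by auto
    show False
    proof (cases rule: source_7)
      case (one p)
      then show False using mods[of p] prime_dvd_P by (auto simp: cong_def)
    next
      case (three p)
      then show False using mods[of p] prime_dvd_P by auto
    qed
  next
    assume t13: "t = 13"
    \<comment> \<open>The same completion, from
      \<open>336 * (Q - 1) * (R - 1) \<le> 325 * Q * R\<close> and the factor 11.\<close>
    have B: "(11 * int Q - 336) * (11 * int R - 336) \<le> 109200"
      using B t13 by (simp add: algebra_simps)
    have "Q \<le> 60"
    proof (rule ccontr)
      assume "\<not> Q \<le> 60"
      then have "335 * 346 \<le> (11 * int Q - 336) * (11 * int R - 336)"
        using QR(5) by (intro mult_mono) auto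
      then show False using B by simp
    qed
    moreover have "Q \<noteq> 51" using pr(2) by auto
    ultimately have Q: "Q = 31 \<or> Q = 41" using Q31 m10(1) by presburger
    have mods: "p = R \<or> p mod 7 \<in> {3, 5, 6}" if "p \<in> P" for p
      using that t(1) Q t13 by auto
    \<comment> \<open>Only \<open>R\<close> can supply the factor 7. The case of two distinct primes
      that are 1 modulo 7 is therefore impossible, and the residues modulo 2, 3, 5 and 7
      combine.\<close>
    have R: "R mod 210 \<in> {11, 191}"
    proof (cases rule: source_7)
      case (one p)
      obtain p' where p': "prime p'" "p' dvd k" "[p' = 1] (mod 7)" "p' \<noteq> p"
        using second_prime_7[OF one(1,3,4)] by blast
      then show ?thesis
        using mods[of p] mods[of p'] prime_dvd_P one by (auto simp: cong_def)
    next
      case (three p)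
      then have "p = R" using mods[of p] prime_dvd_P by auto
      then show ?thesis
        using mod_210_cases mod_42_cases[OF three(4) _ three(3)] pr(4) QR(4) by blast
    qed
    from Q show False
    proof
      assume "Q = 41"
      then have "R \<le> 116" using B by simp
      then have "R mod 210 = R" by simp
      then show False using R R41 \<open>R \<le> 116\<close> by auto
    next
      assume Q: "Q = 31"
      then have R2016: "R \<le> 2016" using B by simp
      obtain p where p: "prime p" "p dvd k" "[p = 1] (mod 5)" "(\<Sum>i<5. p ^ i) dvd 7 * k"
        by (rule source_5)
      have "p \<in> P" "p mod 5 = 1" using p prime_dvd_P by (auto simp: cong_def)
      then have "p = 31 \<or> p = R" using t Q t13 by auto
      then show False
      proof
        assume "p = 31"
        \<comment> \<open>The value at 31 is \<open>5 * 11 * 17351\<close>, which would make 11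
          divide \<open>k\<close>.\<close>
        then have "954305 dvd 7 * k" using p(4) by (simp add: geometric_sum_5)
        then have "11 dvd 7 * k" using dvd_trans[of 11 954305 "7 * k"] by simp
        then show False using prime_dvd_7k[of 11] not_eleven_dvd by simp
      next
        assume pR: "p = R"
        have 5: "prime (5::nat)" and 31: "prime (31::nat)" by simp_all
        \<comment> \<open>7 and 13 are not 1 modulo 5, and \<open>R\<close> does not divide its own
          sum.\<close>
        have only: "y = 5 \<or> y = 31" if "prime y" "y dvd (\<Sum>i<5. R ^ i)" for y
          using cyclotomic_prime_in_P[OF 5 QR(2) p(4)[unfolded pR] that] t(1) Q t13 by auto
        note five = five_cyclotomic[OF p(3)[unfolded pR] prime_gt_1_nat[OF prime_P[OF QR(2)]]]
        obtain j where j: "(\<Sum>i<5. R ^ i) = 5 * 31 ^ j" "j > 0"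
          using two_prime_factors_imp[OF five(3) 5 31 five(1,2) only] by blast
        have "41 ^ 2 \<le> R ^ 2" using R41 by (intro power_mono) auto
        then have "(\<Sum>i<5. R ^ i) > 155" by (simp add: geometric_sum_5)
        then have "j \<noteq> 1" using j(1) by auto
        then have "2 \<le> j" using j(2) by linarith
        then have "31 ^ 2 dvd (31 ^ j :: nat)" by (rule le_imp_power_dvd)
        then have "961 dvd (\<Sum>i<5. R ^ i)" unfolding j(1) by simp
        then show False using not_961_dvd[OF R _ R2016] R41 by simp
      qed
    qed
  qed
qed

end

section \<open>Five prime divisors of the odd part, and the theorem\<close>

context half_friend
begin

lemma card_prime_factors_ge_5: "card (prime_factors k) \<ge> 5"
proof (rule ccontr)
  assume "\<not> card (prime_factors k) \<ge> 5"
  then have "card (prime_factors k) \<le> 4" by simp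
  then obtain P where P: "finite P" "prime_factors k \<subseteq> P" "card P = 4" "\<And>p. p \<in> P \<Longrightarrow> prime p"
    "\<And>p. p \<in> P \<Longrightarrow> p \<in> prime_factors k \<or> p > 10000"
    \<comment> \<open>The padding primes only have to avoid 2, 3, 7, 11 and be at least 59; 10000 is
      ample.\<close>
    using ex_finite_superset_primes[of "prime_factors k" 4 10000] by auto
  have "few_primes k P"
  proof unfold_locales
    fix p assume "prime p" "p dvd k"
    then show "p \<in> P" using P(2) k_pos by (auto simp: in_prime_factors_iff)
  next
    fix p assume "p \<in> P"
    then show "p dvd k \<or> p > 10000" using P(5) by auto
  qed (use P in auto)
  then show False by (rule few_primes.few_primes_impossible)
qed

end

lemma even_multiplicity_imp_square:
  fixes n :: nat
  assumes "n > 0" "\<And>p. prime p \<Longrightarrow> even (multiplicity p n)"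
  obtains m where "n = m ^ 2"
proof -
  have "n = (\<Prod>p\<in>prime_factors n. p ^ multiplicity p n)"
    using prime_factorization_nat assms(1) by blast
  also have "\<dots> = (\<Prod>p\<in>prime_factors n. (p ^ (multiplicity p n div 2)) ^ 2)"
    by (rule prod.cong) (use assms(2) in \<open>simp_all add: power_mult[symmetric] in_prime_factors_iff\<close>)
  also have "\<dots> = (\<Prod>p\<in>prime_factors n. p ^ (multiplicity p n div 2)) ^ 2"
    by (rule prod_power_distrib[symmetric])
  finally show thesis by (rule that)
qed

theorem theorem1:
  fixes N :: nat
  assumes "friend_of_20 N"
  shows "(\<exists>a m :: nat. a > 0 \<and> m > 0 \<and> N = 2 * 5 ^ (2 * a) * m\<^sup>2 \<and> gcd 3 m = 1 \<and> gcd 7 m = 1)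
         \<and> card (prime_factors N) \<ge> 6"
proof -
  have N: "N > 20" "abundancy N = 21 / 10"
    using assms abundancy_20 by (auto simp: friend_of_20_def)
  then have "real (10 * divisor_sigma N) = real (21 * N)"
    by (simp add: abundancy_def field_simps)
  then have eq: "10 * divisor_sigma N = 21 * N" by (simp only: of_nat_eq_iff)
  then have "even N" "5 dvd N" by presburger+
  have "\<not> 4 dvd N"
  proof
    assume "4 dvd N"
    then have "20 dvd N" using \<open>5 dvd N\<close> by presburger
    then obtain c where c: "N = 20 * c" by blast
    then have "c > 1" using N(1) by simp
    then have "divisor_sigma 20 * c < divisor_sigma N"
      using divisor_sigma_mult_le(2)[of 20 c] c by simp
    moreover have "divisor_sigma 20 = 42"
      using abundancy_20 by (simp add: abundancy_def)
    ultimately show False using eq c by simp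
  qed
  obtain k where k: "N = 2 * k" using \<open>even N\<close> by blast
  have odd: "odd k" using \<open>\<not> 4 dvd N\<close> k by presburger
  have "coprime 2 k" using odd by simp
  then have "divisor_sigma N = divisor_sigma 2 * divisor_sigma k"
    unfolding k by (rule divisor_sigma_mult_coprime)
  moreover have "divisor_sigma 2 = 3"
    using divisor_sigma_prime_power[of 2 1] by simp
  ultimately have "5 * divisor_sigma k = 7 * k" using eq k by simp
  with odd interpret half_friend k by unfold_locales
  obtain n where n: "k = n ^ 2"
    using even_multiplicity_imp_square[OF k_pos even_multiplicity] .
  have "5 dvd n" using five_dvd n prime_dvd_power[of 5 n 2] by simp
  then obtain m where m: "n = 5 * m" by blast
  have "m > 0" using k_pos n m by (auto intro: Nat.gr0I)
  moreover have "N = 2 * 5 ^ (2 * 1) * m\<^sup>2" using k n m by (simp add: power_mult_distrib)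
  moreover have "\<not> 3 dvd m" "\<not> 7 dvd m"
    using not_dvd_3 not_dvd_7 unfolding n m by (auto simp: power2_eq_square)
  then have "coprime 3 m" "coprime 7 m" by (auto intro!: prime_imp_coprime)
  then have "gcd 3 m = 1" "gcd 7 m = 1" by (simp_all only: coprime_iff_gcd_eq_1)
  \<comment> \<open>The witness \<open>a = 1\<close> always works, since \<open>m\<close> may itself
    contain further factors 5.\<close>
  ultimately have "\<exists>a m :: nat. a > 0 \<and> m > 0 \<and> N = 2 * 5 ^ (2 * a) * m\<^sup>2 \<and> gcd 3 m = 1 \<and> gcd 7 m = 1"
    by (intro exI[of _ 1] exI[of _ m]) simp
  moreover have "prime_factors N = insert 2 (prime_factors k)"
    unfolding k using k_pos by (simp add: prime_factors_product prime_factorization_prime)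
  moreover have "2 \<notin> prime_factors k" using odd by auto
  ultimately show ?thesis using card_prime_factors_ge_5 by simp
qed

end
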